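(* Let $\alpha\in\mathbb{N}_0$, $\beta>-1$ and $N>0$. The combined differential operator $$L_{2\alpha+4,x}^{\alpha,\beta,N}f=N\,L_{2\alpha+4,x}^{\alpha,\beta}f+C_{\alpha,\beta}\,L_{2,x}^{\alpha,\beta}f,\qquad f\in C^{(2\alpha+4)}[-1,1],$$ is symmetric with respect to the scalar product $$(f,g)_{w(\alpha,\beta,0,N)}=\int_{-1}^{1}f(x)g(x)\,w_{\alpha,\beta}(x)\,dx+N f(1)g(1),\qquad f,g\in C[-1,1],$$ that is, $$(L_{2\alpha+4,x}^{\alpha,\beta,N}f,g)_{w(\alpha,\beta,0,N)}=(f,L_{2\alpha+4,x}^{\alpha,\beta,N}g)_{w(\alpha,\beta,0,N)}\qquad\text{for all } f,g\in C^{(2\alpha+4)}[-1,1].$$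
   Context: $\mathbb{N}_0=\{0,1,2,\dots\}$; $(a)_k=a(a+1)\cdots(a+k-1)$, $(a)_0=1$; $D_x^i$ is $i$-fold differentiation with respect to $x$; functions are real-valued. $C^{(m)}[-1,1]$ denotes the $m$ times continuously differentiable functions on $[-1,1]$. Weight: $w_{\alpha,\beta}(x)=h_{\alpha,\beta}^{-1}(1-x)^{\alpha}(1+x)^{\beta}$ with $h_{\alpha,\beta}=\int_{-1}^1(1-x)^\alpha(1+x)^\beta dx=2^{\alpha+\beta+1}\Gamma(\alpha+1)\Gamma(\beta+1)/\Gamma(\alpha+\beta+2)$. Operators: $$L_{2\alpha+4,x}^{\alpha,\beta}y(x)=\frac{x-1}{(x+1)^{\beta}}D_x^{\alpha+2}\Big\{(x+1)^{\alpha+\beta+2}D_x^{\alpha+2}\big[(x-1)^{\alpha+1}y(x)\big]\Big\},$$ which upon expansion by the Leibniz rule is a linear differential expression in $y$ with polynomial coefficients, and is understood in this way on all of $[-1,1]$; and $$L_{2,x}^{\alpha,\beta}y(x)=\big\{(x^2-1)D_x^2+[\alpha-\beta+(\alpha+\beta+2)x]D_x\big\}y(x).$$ The constant is $C_{\alpha,\beta}=(\alpha+2)!\,(\beta+1)_{\alpha+1}$. *)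

theory Defs
  imports "HOL-Analysis.Analysis"
begin

section \<open>Differentiation on the closed interval\<close>

text \<open>
  Derivatives are taken relative to the interval, hence one-sided at the end points: values of
  a function outside \<open>[-1,1]\<close> never matter.
\<close>

definition D_itv :: "nat \<Rightarrow> (real \<Rightarrow> real) \<Rightarrow> real \<Rightarrow> real" where
  "D_itv i = ((\<lambda>f x. vector_derivative f (at x within {-1..1})) ^^ i)"

definition C_itv :: "nat \<Rightarrow> (real \<Rightarrow> real) set" where
  "C_itv m = {f. (\<forall>k<m. D_itv k f differentiable_on {-1..1}) \<and> continuous_on {-1..1} (D_itv m f)}"


section \<open>Weight and scalar product\<close>

definition jacobi_h :: "nat \<Rightarrow> real \<Rightarrow> real" where
  "jacobi_h \<alpha> \<beta> = integral {-1..1} (\<lambda>x. (1 - x) ^ \<alpha> * (1 + x) powr \<beta>)"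

definition jacobi_weight :: "nat \<Rightarrow> real \<Rightarrow> real \<Rightarrow> real" where
  "jacobi_weight \<alpha> \<beta> x = inverse (jacobi_h \<alpha> \<beta>) * (1 - x) ^ \<alpha> * (1 + x) powr \<beta>"

definition jacobi_sprod :: "nat \<Rightarrow> real \<Rightarrow> real \<Rightarrow> (real \<Rightarrow> real) \<Rightarrow> (real \<Rightarrow> real) \<Rightarrow> real" where
  "jacobi_sprod \<alpha> \<beta> N f g =
     integral {-1..1} (\<lambda>x. f x * g x * jacobi_weight \<alpha> \<beta> x) + N * f 1 * g 1"


section \<open>The differential operators\<close>

definition falling :: "real \<Rightarrow> nat \<Rightarrow> real" where
  "falling s j = (\<Prod>i<j. s - real i)"

definition L_high_factored :: "nat \<Rightarrow> real \<Rightarrow> (real \<Rightarrow> real) \<Rightarrow> real \<Rightarrow> real" where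
  "L_high_factored \<alpha> \<beta> y x = (x - 1) / (x + 1) powr \<beta> *
     D_itv (\<alpha>+2) (\<lambda>t. (t + 1) powr (real \<alpha> + \<beta> + 2) *
       D_itv (\<alpha>+2) (\<lambda>u. (u - 1) ^ (\<alpha> + 1) * y u) t) x"

text \<open>
  \<open>L_high\<close> is the Leibniz expansion of \<open>L_high_factored\<close>. With \<open>s = \<alpha>+\<beta>+2\<close>, the outer
  derivative produces \<open>falling s j * (x+1) powr (s-j)\<close>, and division by \<open>(x+1) powr \<beta>\<close> leaves
  the polynomial \<open>(x+1)^(\<alpha>+2-j)\<close>; the derivatives of order \<open>2\<alpha>+4-j\<close> of \<open>(x-1)^(\<alpha>+1) * y\<close>
  are expanded in the same way. Terms with
  \<open>i > \<alpha>+1\<close> vanish since \<open>falling (\<alpha>+1) i = 0\<close>. All coefficients are polynomials in \<open>x\<close>, so the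
  expression makes sense at \<open>x = -1\<close> too. Lemma \<open>L_high_eq_factored\<close> below shows
  that it equals the factored form on the rest of the interval.
\<close>

definition L_high :: "nat \<Rightarrow> real \<Rightarrow> (real \<Rightarrow> real) \<Rightarrow> real \<Rightarrow> real" where
  "L_high \<alpha> \<beta> y x = (x - 1) *
     (\<Sum>j\<le>\<alpha>+2. real ((\<alpha>+2) choose j) * falling (real \<alpha> + \<beta> + 2) j * (x + 1) ^ (\<alpha> + 2 - j) *
       (\<Sum>i\<le>2*\<alpha>+4-j. real ((2*\<alpha>+4-j) choose i) * falling (real (\<alpha>+1)) i * (x - 1) ^ (\<alpha> + 1 - i) *
          D_itv (2*\<alpha>+4-j-i) y x))"

definition L_two :: "nat \<Rightarrow> real \<Rightarrow> (real \<Rightarrow> real) \<Rightarrow> real \<Rightarrow> real" where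
  "L_two \<alpha> \<beta> y x =
     (x\<^sup>2 - 1) * D_itv 2 y x + (real \<alpha> - \<beta> + (real \<alpha> + \<beta> + 2) * x) * D_itv 1 y x"

definition C_const :: "nat \<Rightarrow> real \<Rightarrow> real" where
  "C_const \<alpha> \<beta> = fact (\<alpha> + 2) * pochhammer (\<beta> + 1) (\<alpha> + 1)"

definition L_comb :: "nat \<Rightarrow> real \<Rightarrow> real \<Rightarrow> (real \<Rightarrow> real) \<Rightarrow> real \<Rightarrow> real" where
  "L_comb \<alpha> \<beta> N f x = N * L_high \<alpha> \<beta> f x + C_const \<alpha> \<beta> * L_two \<alpha> \<beta> f x"


section \<open>The expanded operator agrees with the factored one off the point -1\<close>

lemma D_itv_0 [simp]: "D_itv 0 f = f"
  by (simp add: D_itv_def)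

lemma D_itv_Suc: "D_itv (Suc n) f x = vector_derivative (D_itv n f) (at x within {-1..1})"
  by (simp add: D_itv_def)

lemma D_itv_add: "D_itv m (D_itv n f) = D_itv (m + n) f"
  by (simp add: D_itv_def funpow_add)

lemma D_itv_SucI:
  assumes "(D_itv n f has_real_derivative d) (at x within {-1..1})" "x \<in> {-1..1}"
  shows "D_itv (Suc n) f x = d"
  unfolding D_itv_Suc using assms
  by (intro vector_derivative_within_closed_interval)
     (auto simp: has_real_derivative_iff_has_vector_derivative)

lemma C_itv_has_derivative:
  assumes "f \<in> C_itv m" "k < m" "x \<in> {-1..1}"
  shows "(D_itv k f has_real_derivative D_itv (Suc k) f x) (at x within {-1..1})"
  using assms unfolding C_itv_def D_itv_Suc has_real_derivative_iff_has_vector_derivative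
  by (auto simp: differentiable_on_def vector_derivative_works[symmetric])

lemma C_itv_continuous:
  assumes "f \<in> C_itv m" "k \<le> m"
  shows "continuous_on {-1..1} (D_itv k f)"
  using assms unfolding C_itv_def
  by (cases "k = m") (auto intro!: differentiable_imp_continuous_on)

lemma has_derivative_cong_on:
  assumes "open T" "x \<in> {-1..1} \<inter> T" "\<And>y. y \<in> {-1..1} \<inter> T \<Longrightarrow> h y = k y"
    and "(h has_real_derivative d) (at x within {-1..1})"
  shows "(k has_real_derivative d) (at x within {-1..1})"
proof -
  obtain e where "e > 0" "ball x e \<subseteq> T" using assms(1,2) openE by blast
  then show ?thesis
    using assms by (intro has_field_derivative_transform_within[OF assms(4), of e])
                   (auto simp: dist_commute subset_iff)
qed

lemma D_itv_chain:
  assumes T: "open T"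
    and H: "\<And>k x. k < n \<Longrightarrow> x \<in> {-1..1} \<inter> T \<Longrightarrow>
               (H k has_real_derivative H (Suc k) x) (at x within {-1..1})"
    and h: "\<And>x. x \<in> {-1..1} \<inter> T \<Longrightarrow> h x = H 0 x"
    and k: "k \<le> n" and x: "x \<in> {-1..1} \<inter> T"
  shows "D_itv k h x = H k x"
  using k x
proof (induction k arbitrary: x)
  case 0
  then show ?case using h by simp
next
  case (Suc k)
  have "(D_itv k h has_real_derivative H (Suc k) x) (at x within {-1..1})"
    by (rule has_derivative_cong_on[OF T Suc.prems(2) _ H]) (use Suc in auto)
  then show ?case using Suc.prems by (intro D_itv_SucI) auto
qed

lemma leibniz_derivative:
  fixes F G :: "nat \<Rightarrow> real \<Rightarrow> real"
  assumes "\<And>k. k \<le> n \<Longrightarrow> (F k has_real_derivative F (Suc k) x) (at x within A)"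
    and "\<And>k. k \<le> n \<Longrightarrow> (G k has_real_derivative G (Suc k) x) (at x within A)"
  shows "((\<lambda>x. \<Sum>k\<le>n. real (n choose k) * F k x * G (n - k) x) has_real_derivative
           (\<Sum>k\<le>Suc n. real (Suc n choose k) * F k x * G (Suc n - k) x)) (at x within A)"
proof -
  have "((\<lambda>x. \<Sum>k\<le>n. real (n choose k) * F k x * G (n - k) x) has_real_derivative
         (\<Sum>k\<le>n. real (n choose k) * F (Suc k) x * G (n - k) x + real (n choose k) * F k x * G (Suc n - k) x)) (at x within A)"
    by (rule DERIV_sum)
       (auto intro!: derivative_eq_intros assms(1,2) simp: Suc_diff_le algebra_simps)
  also have "(\<Sum>k\<le>n. real (n choose k) * F (Suc k) x * G (n - k) x + real (n choose k) * F k x * G (Suc n - k) x)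
     = (\<Sum>k\<le>n. real (n choose k) * F (Suc k) x * G (n - k) x) + (\<Sum>k\<le>Suc n. real (n choose k) * F k x * G (Suc n - k) x)"
    by (simp add: sum.distrib)
  also have "\<dots> = (\<Sum>k\<le>Suc n. real (Suc n choose k) * F k x * G (Suc n - k) x)"
    by (subst (1 2) sum.atMost_Suc_shift) (simp add: sum.distrib[symmetric] algebra_simps del: sum.atMost_Suc)
  finally show ?thesis .
qed

lemma D_itv_leibniz:
  assumes T: "open T"
    and F: "\<And>k x. k < n \<Longrightarrow> x \<in> {-1..1} \<inter> T \<Longrightarrow>
               (F k has_real_derivative F (Suc k) x) (at x within {-1..1})"
    and G: "\<And>k x. k < n \<Longrightarrow> x \<in> {-1..1} \<inter> T \<Longrightarrow>
               (G k has_real_derivative G (Suc k) x) (at x within {-1..1})"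
    and k: "k \<le> n" and x: "x \<in> {-1..1} \<inter> T"
  shows "D_itv k (\<lambda>x. F 0 x * G 0 x) x = (\<Sum>j\<le>k. real (k choose j) * F j x * G (k - j) x)"
proof (rule D_itv_chain[OF T _ _ k x])
  show "((\<lambda>x. \<Sum>j\<le>k. real (k choose j) * F j x * G (k - j) x) has_real_derivative
          (\<Sum>j\<le>Suc k. real (Suc k choose j) * F j x * G (Suc k - j) x)) (at x within {-1..1})"
    if "k < n" "x \<in> {-1..1} \<inter> T" for k x
    by (rule leibniz_derivative; rule F G) (use that in auto)
qed simp

lemma falling_Suc: "falling s (Suc j) = falling s j * (s - real j)"
  by (simp add: falling_def)

lemma falling_eq_0: "n < i \<Longrightarrow> falling (real n) i = 0"
  by (auto simp: falling_def intro!: bexI[of _ n])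

lemma has_derivative_poly_term:
  "((\<lambda>x. falling (real n) i * (x - 1) ^ (n - i)) has_real_derivative
     falling (real n) (Suc i) * (x - 1) ^ (n - Suc i)) (at x within A)"
proof (cases "i < n")
  case True
  then show ?thesis
    by (auto intro!: derivative_eq_intros simp: falling_Suc of_nat_diff)
next
  case False
  then show ?thesis by (auto simp: falling_eq_0)
qed

lemma D_itv_inner:
  assumes "y \<in> C_itv m" "k \<le> m" "x \<in> {-1..1}"
  shows "D_itv k (\<lambda>u. (u - 1) ^ n * y u) x =
         (\<Sum>i\<le>k. real (k choose i) * falling (real n) i * (x - 1) ^ (n - i) * D_itv (k - i) y x)"
    and "k < m \<Longrightarrow> (D_itv k (\<lambda>u. (u - 1) ^ n * y u) has_real_derivative
            D_itv (Suc k) (\<lambda>u. (u - 1) ^ n * y u) x) (at x within {-1..1})"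
proof -
  define F where "F i x = falling (real n) i * (x - 1) ^ (n - i)" for i and x :: real
  have F: "(F i has_real_derivative F (Suc i) x) (at x within {-1..1})" for i x
    unfolding F_def by (rule has_derivative_poly_term)
  have F0: "F 0 x = (x - 1) ^ n" for x by (simp add: F_def falling_def)
  have eq: "D_itv k (\<lambda>u. (u - 1) ^ n * y u) x = (\<Sum>i\<le>k. real (k choose i) * F i x * D_itv (k - i) y x)"
    if "k \<le> m" "x \<in> {-1..1}" for k x
    using D_itv_leibniz[of UNIV m F "\<lambda>k. D_itv k y" k x] F C_itv_has_derivative[OF assms(1)] that
    by (simp add: F0)
  show "D_itv k (\<lambda>u. (u - 1) ^ n * y u) x =
         (\<Sum>i\<le>k. real (k choose i) * falling (real n) i * (x - 1) ^ (n - i) * D_itv (k - i) y x)"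
    using eq[OF assms(2,3)] by (simp add: F_def mult.assoc)
  assume "k < m"
  have "((\<lambda>x. \<Sum>i\<le>k. real (k choose i) * F i x * D_itv (k - i) y x) has_real_derivative
          (\<Sum>i\<le>Suc k. real (Suc k choose i) * F i x * D_itv (Suc k - i) y x)) (at x within {-1..1})"
    by (rule leibniz_derivative; rule F C_itv_has_derivative[OF assms(1)]) (use \<open>k < m\<close> assms in auto)
  also have "(\<Sum>i\<le>Suc k. real (Suc k choose i) * F i x * D_itv (Suc k - i) y x) =
      D_itv (Suc k) (\<lambda>u. (u - 1) ^ n * y u) x"
    using eq[of "Suc k" x] \<open>k < m\<close> assms(3) by simp
  finally show "(D_itv k (\<lambda>u. (u - 1) ^ n * y u) has_real_derivative
            D_itv (Suc k) (\<lambda>u. (u - 1) ^ n * y u) x) (at x within {-1..1})"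
    by (rule has_derivative_cong_on[of UNIV, rotated -1]) (use assms(2,3) eq in simp_all)
qed

lemma L_high_eq_factored:
  assumes y: "y \<in> C_itv (2*\<alpha>+4)" and x: "-1 < x" "x \<le> 1"
  shows "L_high \<alpha> \<beta> y x = L_high_factored \<alpha> \<beta> y x"
proof -
  define s where "s = real \<alpha> + \<beta> + 2"
  define u where "u = (\<lambda>u. (u - 1) ^ (\<alpha> + 1) * y u)"
  define F where "F j t = falling s j * (t + 1) powr (s - real j)" for j and t :: real
  have F: "(F j has_real_derivative F (Suc j) t) (at t within {-1..1})" if "t > -1" for j t
    unfolding F_def using that
    by (auto intro!: derivative_eq_intros simp: falling_Suc algebra_simps)
  have G: "(D_itv (k + (\<alpha>+2)) u has_real_derivative D_itv (Suc k + (\<alpha>+2)) u t) (at t within {-1..1})"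
    if "k < \<alpha> + 2" "t \<in> {-1..1}" for k t
    using D_itv_inner(2)[OF y, of "k + (\<alpha>+2)" t "\<alpha>+1"] that by (simp add: u_def)
  have "D_itv (\<alpha>+2) (\<lambda>t. F 0 t * D_itv (0 + (\<alpha>+2)) u t) x =
        (\<Sum>j\<le>\<alpha>+2. real ((\<alpha>+2) choose j) * F j x * D_itv (\<alpha>+2-j + (\<alpha>+2)) u x)"
    by (rule D_itv_leibniz[where T = "{-1<..}" and n = "\<alpha>+2"]) (use F G x in auto)
  moreover have "F 0 t = (t + 1) powr s" for t by (simp add: F_def falling_def)
  ultimately have "L_high_factored \<alpha> \<beta> y x = (x - 1) / (x + 1) powr \<beta> *
        (\<Sum>j\<le>\<alpha>+2. real ((\<alpha>+2) choose j) * F j x * D_itv (\<alpha>+2-j + (\<alpha>+2)) u x)"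
    by (simp add: L_high_factored_def s_def u_def)
  also have "\<dots> = (x - 1) * (\<Sum>j\<le>\<alpha>+2. real ((\<alpha>+2) choose j) * (F j x / (x + 1) powr \<beta>) *
                                  D_itv (\<alpha>+2-j + (\<alpha>+2)) u x)"
    by (simp add: sum_distrib_left sum_divide_distrib del: sum.atMost_Suc)
  also have "\<dots> = L_high \<alpha> \<beta> y x"
    unfolding L_high_def
  proof (rule arg_cong[where f = "(*) (x - 1)"], rule sum.cong[OF refl])
    fix j assume j: "j \<in> {..\<alpha>+2}"
    have "F j x / (x + 1) powr \<beta> = falling s j * (x + 1) powr (real (\<alpha> + 2 - j))"
    proof -
      have "s - real j - \<beta> = real (\<alpha> + 2 - j)" using j by (simp add: s_def of_nat_diff)
      then show ?thesis by (metis F_def powr_diff times_divide_eq_right)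
    qed
    also have "\<dots> = falling s j * (x + 1) ^ (\<alpha> + 2 - j)"
      using x by (simp add: powr_realpow)
    finally have 1: "F j x / (x + 1) powr \<beta> = falling s j * (x + 1) ^ (\<alpha> + 2 - j)" .
    have "\<alpha>+2-j + (\<alpha>+2) = 2*\<alpha>+4-j" using j by auto
    then have 2: "D_itv (\<alpha>+2-j + (\<alpha>+2)) u x =
       (\<Sum>i\<le>2*\<alpha>+4-j. real ((2*\<alpha>+4-j) choose i) * falling (real (\<alpha>+1)) i * (x - 1) ^ (\<alpha> + 1 - i) *
          D_itv (2*\<alpha>+4-j-i) y x)"
      using D_itv_inner(1)[OF y, of "2*\<alpha>+4-j" x "\<alpha>+1"] x
      unfolding u_def by (simp only: atLeastAtMost_iff) simp
    show "real ((\<alpha>+2) choose j) * (F j x / (x + 1) powr \<beta>) * D_itv (\<alpha>+2-j + (\<alpha>+2)) u x =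
      real ((\<alpha>+2) choose j) * falling (real \<alpha> + \<beta> + 2) j * (x + 1) ^ (\<alpha> + 2 - j) *
       (\<Sum>i\<le>2*\<alpha>+4-j. real ((2*\<alpha>+4-j) choose i) * falling (real (\<alpha>+1)) i * (x - 1) ^ (\<alpha> + 1 - i) *
          D_itv (2*\<alpha>+4-j-i) y x)"
      unfolding 1 2 s_def by (simp only: mult.assoc)
  qed
  finally show ?thesis by simp
qed

lemma continuous_on_L_comb:
  assumes "f \<in> C_itv (2*\<alpha>+4)"
  shows "continuous_on {-1..1} (L_comb \<alpha> \<beta> N f)"
  unfolding L_comb_def L_high_def L_two_def
  by (intro continuous_intros C_itv_continuous[OF assms]) auto

end

theory Submission
  imports Defs
begin

text \<open>
  Write \<open>s = \<alpha>+\<beta>+2\<close>, \<open>n = \<alpha>+2\<close>, \<open>u = (x-1)^(\<alpha>+1) f\<close> and \<open>v = (x-1)^(\<alpha>+1) g\<close>. Against the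
  unnormalised weight \<open>(1-x)^\<alpha> (1+x)^\<beta>\<close>, the factor \<open>x-1\<close> and the division by \<open>(1+x)^\<beta>\<close> in the
  high order operator leave \<open>(-1)^\<alpha> v D^n{(1+x)^s D^n u}\<close>. Moving the \<open>n\<close> outer derivatives to
  \<open>v\<close> gives the symmetric density \<open>(1+x)^s D^n u D^n v\<close> and boundary terms. Those at \<open>-1\<close> vanish,
  because every Leibniz term of \<open>D^j{(1+x)^s D^n u}\<close> with \<open>j < n\<close> keeps a factor \<open>(1+x)^a\<close> with \<open>a \<ge> \<beta>+1 > 0\<close>. At \<open>1\<close>
  the zero of order \<open>\<alpha>+1\<close> of \<open>v\<close> removes all of them except the one with \<open>D^(\<alpha>+1) v\<close>, which is
  \<open>-2^s (\<alpha>+1)! (\<alpha>+2)! f'(1) g(1)\<close>. The second order operator is in Sturm-Liouville form,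
  \<open>(1-x)^\<alpha> (1+x)^\<beta> L_two f = -((1-x)^(\<alpha>+1) (1+x)^(\<beta>+1) f')'\<close>, and contributes no boundary term.

  So the integral part of the scalar product is symmetric up to a multiple of
  \<open>f'(1) g(1) - f(1) g'(1)\<close>. The point mass contributes another multiple of the same expression: at
  \<open>1\<close> the high order operator vanishes and \<open>L_two f 1 = (2\<alpha>+2) f'(1)\<close>. The two multiples cancel by
  the value of the normalising constant \<open>h = jacobi_h \<alpha> \<beta>\<close>: with \<open>C = C_const \<alpha> \<beta>\<close>,
  \<open>h C (2\<alpha>+2) = 2^s (\<alpha>+1)! (\<alpha>+2)!\<close>
  (\<open>jacobi_h_times_C_const\<close>).

  All integrations by parts are carried out at once. The boundary terms are collected, as a function
  of \<open>x\<close>, in \<open>boundary_form\<close>, whose derivative is the weighted \<open>L_comb f * g\<close> minus the symmetric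
  \<open>dirichlet\<close> density (\<open>boundary_form_derivative\<close>). Subtracting the same identity with \<open>f\<close> and \<open>g\<close>
  exchanged and integrating once gives \<open>green_formula\<close>. This form of the argument also
  copes with \<open>-1 < \<beta> < 0\<close>, where the integrands are unbounded at \<open>-1\<close>: the fundamental theorem
  asks for continuity of the antiderivative on \<open>[-1,1]\<close> and for its derivative only in the interior.
\<close>

section \<open>The total mass of the Jacobi weight\<close>

lemma continuous_on_one_plus_powr:
  fixes a :: real
  assumes "a > 0"
  shows "continuous_on {-1..1} (\<lambda>x. (1 + x) powr a)"
  using assms by (intro continuous_on_powr' continuous_intros) auto

lemma fundamental_theorem_of_calculus_itv:
  fixes F :: "real \<Rightarrow> real"
  assumes "continuous_on {-1..1} F"
    and "\<And>x. x \<in> {-1<..<1} \<Longrightarrow> (F has_real_derivative F' x) (at x within {-1..1})"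
  shows "(F' has_integral F 1 - F (-1)) {-1..1}"
proof (rule fundamental_theorem_of_calculus_interior)
  show "(F has_vector_derivative F' x) (at x)" if "x \<in> {-1<..<1}" for x
    using assms(2)[OF that] that at_within_Icc_at[of "-1" x 1]
    by (simp add: has_real_derivative_iff_has_vector_derivative)
qed (use assms in auto)

text \<open>
  Integrating \<open>(1+x)^\<beta>\<close> and differentiating \<open>(1-x)^(\<alpha>+1)\<close> trades the parameters \<open>(\<alpha>+1, \<beta>)\<close> for
  \<open>(\<alpha>, \<beta>+1)\<close>; hence the induction on \<open>\<alpha>\<close> with \<open>\<beta>\<close> arbitrary.
\<close>

lemma has_integral_jacobi_weight:
  assumes "\<beta> > -1"
  shows "((\<lambda>x. (1 - x) ^ \<alpha> * (1 + x) powr \<beta>) has_integral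
           2 powr (real \<alpha> + \<beta> + 1) * fact \<alpha> / pochhammer (\<beta> + 1) (\<alpha> + 1)) {-1..1}"
  using assms
proof (induction \<alpha> arbitrary: \<beta>)
  case 0
  have "((\<lambda>x. (1 + x) powr \<beta>) has_integral
      (1 + 1) powr (\<beta> + 1) / (\<beta> + 1) - (1 + -1) powr (\<beta> + 1) / (\<beta> + 1)) {-1..1::real}"
    using 0
    by (intro fundamental_theorem_of_calculus_itv continuous_intros continuous_on_one_plus_powr)
       (auto intro!: derivative_eq_intros)
  then show ?case using 0 by (simp add: add_ac)
next
  case (Suc \<alpha>)
  define F where "F x = (1 - x) ^ Suc \<alpha> * (1 + x) powr (\<beta> + 1) / (\<beta> + 1)" for x :: real
  have "((\<lambda>x. (1 - x) ^ Suc \<alpha> * (1 + x) powr \<beta>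
            - (real \<alpha> + 1) / (\<beta> + 1) * ((1 - x) ^ \<alpha> * (1 + x) powr (\<beta> + 1)))
          has_integral F 1 - F (-1)) {-1..1}"
  proof (rule fundamental_theorem_of_calculus_itv)
    show "continuous_on {-1..1} F"
      unfolding F_def using Suc.prems by (intro continuous_intros continuous_on_one_plus_powr) auto
    show "(F has_real_derivative (1 - x) ^ Suc \<alpha> * (1 + x) powr \<beta>
            - (real \<alpha> + 1) / (\<beta> + 1) * ((1 - x) ^ \<alpha> * (1 + x) powr (\<beta> + 1))) (at x within {-1..1})"
      if "x \<in> {-1<..<1}" for x
    proof -
      have "((\<lambda>x. (1 - x) ^ Suc \<alpha> * (1 + x) powr (\<beta> + 1)) has_real_derivative
          (\<beta> + 1) * ((1 - x) ^ Suc \<alpha> * (1 + x) powr \<beta>)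
            - (real \<alpha> + 1) * ((1 - x) ^ \<alpha> * (1 + x) powr (\<beta> + 1))) (at x within {-1..1})"
        using that by (auto intro!: derivative_eq_intros simp del: power_Suc simp: algebra_simps)
      from DERIV_cdivide[OF this, of "\<beta> + 1"] show ?thesis
        unfolding F_def by (rule DERIV_cong) (use Suc.prems in \<open>simp add: diff_divide_distrib\<close>)
    qed
  qed
  then have "((\<lambda>x. (1 - x) ^ Suc \<alpha> * (1 + x) powr \<beta>
            - (real \<alpha> + 1) / (\<beta> + 1) * ((1 - x) ^ \<alpha> * (1 + x) powr (\<beta> + 1)))
          has_integral 0) {-1..1}"
    by (simp add: F_def)
  moreover have "((\<lambda>x. (real \<alpha> + 1) / (\<beta> + 1) * ((1 - x) ^ \<alpha> * (1 + x) powr (\<beta> + 1))) has_integral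
      (real \<alpha> + 1) / (\<beta> + 1) *
        (2 powr (real \<alpha> + (\<beta> + 1) + 1) * fact \<alpha> / pochhammer (\<beta> + 1 + 1) (\<alpha> + 1))) {-1..1}"
    using Suc.prems by (intro has_integral_mult_right Suc.IH) auto
  ultimately have "((\<lambda>x. (1 - x) ^ Suc \<alpha> * (1 + x) powr \<beta>) has_integral
      (real \<alpha> + 1) / (\<beta> + 1) *
        (2 powr (real \<alpha> + (\<beta> + 1) + 1) * fact \<alpha> / pochhammer (\<beta> + 1 + 1) (\<alpha> + 1))) {-1..1}"
    by (rule has_integral_add[THEN has_integral_eq_rhs, THEN has_integral_eq[rotated]]) auto
  moreover have "pochhammer (\<beta> + 1) (Suc \<alpha> + 1) = (\<beta> + 1) * pochhammer (\<beta> + 1 + 1) (\<alpha> + 1)"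
    using pochhammer_rec[of "\<beta> + 1" "\<alpha> + 1"] by simp
  ultimately show ?case by (simp add: add_ac mult_ac)
qed

lemma jacobi_h_eq:
  assumes "\<beta> > -1"
  shows "jacobi_h \<alpha> \<beta> = 2 powr (real \<alpha> + \<beta> + 1) * fact \<alpha> / pochhammer (\<beta> + 1) (\<alpha> + 1)"
  unfolding jacobi_h_def by (rule integral_unique[OF has_integral_jacobi_weight[OF assms]])

text \<open>
  Needed to split the integral of the difference in Green's formula into the two integrals of the
  scalar products. For negative \<open>\<beta>\<close> the weight is unbounded, so continuity of the integrand on the
  closed interval is not available; absolute integrability of the positive weight is used instead.
\<close>

lemma integrable_continuous_mult_jacobi_weight:
  fixes F :: "real \<Rightarrow> real"
  assumes "\<beta> > -1" and "continuous_on {-1..1} F"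
  shows "(\<lambda>x. F x * ((1 - x) ^ \<alpha> * (1 + x) powr \<beta>)) integrable_on {-1..1}"
proof -
  have "(\<lambda>x. F x * ((1 - x) ^ \<alpha> * (1 + x) powr \<beta>)) absolutely_integrable_on {-1..1}"
  proof (rule absolutely_integrable_bounded_measurable_product_real)
    show "F \<in> borel_measurable (lebesgue_on {-1..1})"
      by (rule continuous_imp_measurable_on_sets_lebesgue[OF assms(2)]) auto
    show "bounded (F ` {-1..1})"
      by (rule compact_imp_bounded[OF compact_continuous_image[OF assms(2)]]) auto
    show "(\<lambda>x. (1 - x) ^ \<alpha> * (1 + x) powr \<beta>) absolutely_integrable_on {-1..1}"
      by (rule nonnegative_absolutely_integrable_1)
         (use has_integral_jacobi_weight[OF assms(1)] in auto)
  qed auto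
  then show ?thesis by (rule set_lebesgue_integral_eq_integral)
qed

section \<open>The bilinear concomitant of an iterated derivative\<close>

text \<open>
  \<open>n\<close>-fold integration by parts in differential form. Every summand contributes two products, one of
  which cancels against a product of the next summand, so that the sum telescopes.
\<close>

lemma concomitant_derivative:
  fixes V W :: "nat \<Rightarrow> real \<Rightarrow> real"
  assumes "\<And>k. k < n \<Longrightarrow> (V k has_real_derivative V (Suc k) x) (at x within A)"
    and "\<And>k. k < n \<Longrightarrow> (W k has_real_derivative W (Suc k) x) (at x within A)"
  shows "((\<lambda>x. \<Sum>k<n. (-1) ^ k * V k x * W (n - 1 - k) x) has_real_derivative
           V 0 x * W n x - (-1) ^ n * V n x * W 0 x) (at x within A)"
proof -
  have "((\<lambda>x. \<Sum>k<n. (-1) ^ k * V k x * W (n - 1 - k) x) has_real_derivative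
         (\<Sum>k<n. (-1) ^ k * V k x * W (n - k) x - (-1) ^ Suc k * V (Suc k) x * W (n - Suc k) x))
         (at x within A)"
  proof (rule DERIV_sum)
    fix k assume "k \<in> {..<n}"
    then have k: "k < n" "n - 1 - k < n" "Suc (n - 1 - k) = n - k" "n - Suc k = n - 1 - k"
      by auto
    show "((\<lambda>x. (-1) ^ k * V k x * W (n - 1 - k) x) has_real_derivative
       (-1) ^ k * V k x * W (n - k) x - (-1) ^ Suc k * V (Suc k) x * W (n - Suc k) x) (at x within A)"
      using assms(1)[OF k(1)] assms(2)[OF k(2)] unfolding k(3,4)
      by (auto intro!: derivative_eq_intros simp: algebra_simps)
  qed
  then show ?thesis by (subst (asm) sum_lessThan_telescope') simp
qed

section \<open>The inner and outer functions of the high order operator\<close>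

text \<open>
  Multiplication by \<open>(x-1)^(\<alpha>+1)\<close>, the innermost step of the high order operator.
\<close>

definition lift :: "nat \<Rightarrow> (real \<Rightarrow> real) \<Rightarrow> real \<Rightarrow> real" where
  "lift \<alpha> y = (\<lambda>x. (x - 1) ^ (\<alpha> + 1) * y x)"

text \<open>
  On \<open>(-1,1]\<close> this is the \<open>j\<close>-th derivative of \<open>(1+x)^(\<alpha>+\<beta>+2) D^(\<alpha>+2) (lift \<alpha> y)\<close>, expanded by
  the Leibniz rule. The explicit sum makes the behaviour at \<open>-1\<close> visible: for \<open>j \<le> \<alpha>+1\<close> all
  exponents of \<open>1+x\<close> are positive and the sum extends continuously by \<open>0\<close>.
\<close>

definition flux :: "nat \<Rightarrow> real \<Rightarrow> (real \<Rightarrow> real) \<Rightarrow> nat \<Rightarrow> real \<Rightarrow> real" where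
  "flux \<alpha> \<beta> y j x = (\<Sum>i\<le>j. real (j choose i) *
     (falling (real \<alpha> + \<beta> + 2) i * (1 + x) powr (real \<alpha> + \<beta> + 2 - real i)) *
     D_itv (j - i + (\<alpha> + 2)) (lift \<alpha> y) x)"

lemma lift_derivative:
  assumes "y \<in> C_itv m" "k < m" "x \<in> {-1..1}"
  shows "(D_itv k (lift \<alpha> y) has_real_derivative D_itv (Suc k) (lift \<alpha> y) x) (at x within {-1..1})"
  using D_itv_inner(2)[of y m k x "\<alpha> + 1"] assms by (simp add: lift_def)

lemma continuous_on_D_lift:
  assumes "y \<in> C_itv m" "k \<le> m"
  shows "continuous_on {-1..1} (D_itv k (lift \<alpha> y))"
proof -
  have "continuous_on {-1..1} (\<lambda>x. \<Sum>i\<le>k. real (k choose i) * falling (real (\<alpha> + 1)) i *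
          (x - 1) ^ (\<alpha> + 1 - i) * D_itv (k - i) y x)"
    by (intro continuous_intros C_itv_continuous[OF assms(1)]) (use assms(2) in auto)
  moreover have "(\<Sum>i\<le>k. real (k choose i) * falling (real (\<alpha> + 1)) i *
          (x - 1) ^ (\<alpha> + 1 - i) * D_itv (k - i) y x) = D_itv k (lift \<alpha> y) x" if "x \<in> {-1..1}" for x
    unfolding lift_def by (rule D_itv_inner(1)[OF assms that, symmetric])
  ultimately show ?thesis by (rule continuous_on_eq)
qed

lemma falling_self: "falling (real n) n = fact n"
proof -
  have "falling (real n) n = (\<Prod>i<n. real (Suc (n - Suc i)))"
    unfolding falling_def by (rule prod.cong) (auto simp: of_nat_diff)
  also have "\<dots> = (\<Prod>i<n. real (Suc i))"
    using prod.nat_diff_reindex[of "\<lambda>i. real (Suc i)" n] by simp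
  also have "\<dots> = fact n"
    by (simp add: fact_prod_Suc atLeast0LessThan del: of_nat_Suc)
  finally show ?thesis .
qed

text \<open>
  The zero of order \<open>\<alpha>+1\<close> at \<open>1\<close>: in the Leibniz expansion only the summand in which the power of
  \<open>x-1\<close> is differentiated exactly \<open>\<alpha>+1\<close> times survives.
\<close>

lemma D_lift_at_1:
  assumes "y \<in> C_itv m" "k \<le> m"
  shows "D_itv k (lift \<alpha> y) 1 =
    (if k < \<alpha> + 1 then 0 else real (k choose (\<alpha> + 1)) * fact (\<alpha> + 1) * D_itv (k - (\<alpha> + 1)) y 1)"
proof -
  have "D_itv k (lift \<alpha> y) 1 = (\<Sum>i\<le>k. real (k choose i) * falling (real (\<alpha> + 1)) i *
          (1 - 1) ^ (\<alpha> + 1 - i) * D_itv (k - i) y 1)"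
    unfolding lift_def by (rule D_itv_inner(1)[OF assms]) auto
  also have "\<dots> = (\<Sum>i\<le>k. if i = \<alpha> + 1
      then real (k choose (\<alpha> + 1)) * fact (\<alpha> + 1) * D_itv (k - (\<alpha> + 1)) y 1 else 0)"
  proof (rule sum.cong[OF refl])
    fix i
    consider "i < \<alpha> + 1" | "i = \<alpha> + 1" | "i > \<alpha> + 1" by linarith
    then show "real (k choose i) * falling (real (\<alpha> + 1)) i * (1 - 1) ^ (\<alpha> + 1 - i) * D_itv (k - i) y 1
      = (if i = \<alpha> + 1 then real (k choose (\<alpha> + 1)) * fact (\<alpha> + 1) * D_itv (k - (\<alpha> + 1)) y 1 else 0)"
    proof cases
      case 1
      then show ?thesis by simp
    next
      case 2
      then show ?thesis by (simp only: falling_self) simp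
    next
      case 3
      then show ?thesis by (simp only: falling_eq_0) simp
    qed
  qed
  finally show ?thesis by simp
qed

lemma flux_0: "flux \<alpha> \<beta> y 0 x = (1 + x) powr (real \<alpha> + \<beta> + 2) * D_itv (\<alpha> + 2) (lift \<alpha> y) x"
  by (simp add: flux_def falling_def)

text \<open>
  The convention \<open>0 powr a = 0\<close> gives this for every \<open>j\<close>; it agrees with the limit from the right
  for \<open>j \<le> \<alpha>+1\<close>, the only orders that enter the boundary terms.
\<close>

lemma flux_at_minus_1: "flux \<alpha> \<beta> y j (-1) = 0"
  by (simp add: flux_def)

lemma flux_derivative:
  assumes "y \<in> C_itv (2 * \<alpha> + 4)" "j < \<alpha> + 2" "-1 < x" "x \<le> 1"
  shows "(flux \<alpha> \<beta> y j has_real_derivative flux \<alpha> \<beta> y (Suc j) x) (at x within {-1..1})"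
  unfolding flux_def
proof (rule leibniz_derivative)
  fix k assume "k \<le> j"
  show "((\<lambda>x. falling (real \<alpha> + \<beta> + 2) k * (1 + x) powr (real \<alpha> + \<beta> + 2 - real k)) has_real_derivative
      falling (real \<alpha> + \<beta> + 2) (Suc k) * (1 + x) powr (real \<alpha> + \<beta> + 2 - real (Suc k))) (at x within {-1..1})"
    using assms(3) by (auto intro!: derivative_eq_intros simp: falling_Suc algebra_simps)
  show "(D_itv (k + (\<alpha> + 2)) (lift \<alpha> y) has_real_derivative D_itv (Suc k + (\<alpha> + 2)) (lift \<alpha> y) x)
      (at x within {-1..1})"
    using lift_derivative[OF assms(1), of "k + (\<alpha> + 2)" x \<alpha>] assms \<open>k \<le> j\<close> by simp
qed

text \<open>
  The smallest exponent of \<open>1+x\<close> that occurs is \<open>\<alpha>+\<beta>+2-j\<close>, which is positive because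
  \<open>j \<le> \<alpha>+1\<close> and \<open>\<beta> > -1\<close>.
\<close>

lemma continuous_on_flux:
  assumes "\<beta> > -1" "y \<in> C_itv (2 * \<alpha> + 4)" "j < \<alpha> + 2"
  shows "continuous_on {-1..1} (flux \<alpha> \<beta> y j)"
  unfolding flux_def
  by (intro continuous_intros continuous_on_one_plus_powr continuous_on_D_lift[OF assms(2)])
     (use assms in auto)

text \<open>
  The weight turns the high order operator into a plain iterated derivative multiplied by
  \<open>(x-1)^(\<alpha>+1)\<close>, which is ready for integration by parts against \<open>lift \<alpha> g\<close>.
\<close>

lemma weighted_L_high:
  assumes y: "y \<in> C_itv (2 * \<alpha> + 4)" and x: "-1 < x" "x \<le> 1"
  shows "(1 - x) ^ \<alpha> * (1 + x) powr \<beta> * L_high \<alpha> \<beta> y x =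
           (-1) ^ \<alpha> * (x - 1) ^ (\<alpha> + 1) * flux \<alpha> \<beta> y (\<alpha> + 2) x"
proof -
  have "D_itv (\<alpha> + 2) (\<lambda>t. (t + 1) powr (real \<alpha> + \<beta> + 2) * D_itv (\<alpha> + 2) (lift \<alpha> y) t) x
      = flux \<alpha> \<beta> y (\<alpha> + 2) x"
    by (rule D_itv_chain[where T = "{-1<..}" and n = "\<alpha> + 2"])
       (use flux_derivative[OF y] x in \<open>auto simp: flux_0 add.commute\<close>)
  then have "L_high \<alpha> \<beta> y x = (x - 1) / (1 + x) powr \<beta> * flux \<alpha> \<beta> y (\<alpha> + 2) x"
    unfolding L_high_eq_factored[OF y x] L_high_factored_def
    by (simp add: lift_def add.commute)
  moreover have "(1 - x) ^ \<alpha> = (-1) ^ \<alpha> * (x - 1) ^ \<alpha>"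
    by (simp flip: power_mult_distrib)
  ultimately show ?thesis using x by simp
qed

section \<open>Green's formula for the combined operator\<close>

text \<open>
  The density of the symmetric bilinear form that remains after all integrations by parts.
\<close>

definition dirichlet :: "nat \<Rightarrow> real \<Rightarrow> real \<Rightarrow> (real \<Rightarrow> real) \<Rightarrow> (real \<Rightarrow> real) \<Rightarrow> real \<Rightarrow> real" where
  "dirichlet \<alpha> \<beta> N f g x =
     N * (1 + x) powr (real \<alpha> + \<beta> + 2) * D_itv (\<alpha> + 2) (lift \<alpha> f) x * D_itv (\<alpha> + 2) (lift \<alpha> g) x
     + C_const \<alpha> \<beta> * (1 - x) ^ (\<alpha> + 1) * (1 + x) powr (\<beta> + 1) * D_itv 1 f x * D_itv 1 g x"

text \<open>
  The boundary terms of all integrations by parts, taken at a variable point \<open>x\<close>: the concomitant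
  of the high order part and the Sturm-Liouville term of the second order part.
\<close>

definition boundary_form :: "nat \<Rightarrow> real \<Rightarrow> real \<Rightarrow> (real \<Rightarrow> real) \<Rightarrow> (real \<Rightarrow> real) \<Rightarrow> real \<Rightarrow> real" where
  "boundary_form \<alpha> \<beta> N f g x =
     N * (-1) ^ \<alpha> * (\<Sum>k<\<alpha>+2. (-1) ^ k * D_itv k (lift \<alpha> g) x * flux \<alpha> \<beta> f (\<alpha> + 2 - 1 - k) x)
     - C_const \<alpha> \<beta> * (1 - x) ^ (\<alpha> + 1) * (1 + x) powr (\<beta> + 1) * D_itv 1 f x * g x"

lemma dirichlet_commute: "dirichlet \<alpha> \<beta> N f g x = dirichlet \<alpha> \<beta> N g f x"
  by (simp add: dirichlet_def)

text \<open>
  The Sturm-Liouville form of the second order operator, combined with the product rule for the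
  factor \<open>g\<close>.
\<close>

lemma two_term_derivative:
  assumes f: "f \<in> C_itv (2 * \<alpha> + 4)" and g: "g \<in> C_itv (2 * \<alpha> + 4)" and x: "-1 < x" "x \<le> 1"
  shows "((\<lambda>x. (1 - x) ^ (\<alpha> + 1) * (1 + x) powr (\<beta> + 1) * D_itv 1 f x * g x) has_real_derivative
     (1 - x) ^ (\<alpha> + 1) * (1 + x) powr (\<beta> + 1) * D_itv 1 f x * D_itv 1 g x
     - (1 - x) ^ \<alpha> * (1 + x) powr \<beta> * L_two \<alpha> \<beta> f x * g x) (at x within {-1..1})"
proof -
  have f1: "(D_itv 1 f has_real_derivative D_itv 2 f x) (at x within {-1..1})"
    using C_itv_has_derivative[OF f, of 1 x] x unfolding Suc_1 by simp
  have g0: "(g has_real_derivative D_itv 1 g x) (at x within {-1..1})"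
    using C_itv_has_derivative[OF g, of 0 x] x by simp
  define w where "w = (1 - x) ^ \<alpha> * (1 + x) powr \<beta>"
  have p: "(1 - x) ^ (\<alpha> + 1) * (1 + x) powr (\<beta> + 1) = w * ((1 - x) * (1 + x))"
    using x by (simp add: w_def powr_add)
  have "((\<lambda>x. (1 - x) ^ (\<alpha> + 1) * (1 + x) powr (\<beta> + 1)) has_real_derivative
     w * ((\<beta> + 1) * (1 - x) - (real \<alpha> + 1) * (1 + x))) (at x within {-1..1})"
  proof (rule DERIV_cong[OF DERIV_mult])
    show "((\<lambda>x. (1 - x) ^ (\<alpha> + 1)) has_real_derivative - (real \<alpha> + 1) * (1 - x) ^ \<alpha>) (at x within {-1..1})"
      by (auto intro!: derivative_eq_intros simp del: power_Suc simp: algebra_simps)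
    show "((\<lambda>x. (1 + x) powr (\<beta> + 1)) has_real_derivative (\<beta> + 1) * (1 + x) powr \<beta>) (at x within {-1..1})"
      using x by (auto intro!: derivative_eq_intros)
    have "(1 + x) powr (\<beta> + 1) = (1 + x) powr \<beta> * (1 + x)"
      using x by (simp add: powr_add)
    then show "- (real \<alpha> + 1) * (1 - x) ^ \<alpha> * (1 + x) powr (\<beta> + 1)
        + (\<beta> + 1) * (1 + x) powr \<beta> * (1 - x) ^ (\<alpha> + 1)
        = w * ((\<beta> + 1) * (1 - x) - (real \<alpha> + 1) * (1 + x))"
      by (simp add: w_def algebra_simps)
  qed
  from DERIV_mult[OF DERIV_mult[OF this f1] g0]
  show ?thesis
    unfolding p w_def[symmetric]
    by (rule DERIV_cong) (simp add: L_two_def algebra_simps power2_eq_square)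
qed

text \<open>
  The signs match because the \<open>(-1)^\<alpha>\<close> coming from \<open>(1-x)^\<alpha> = (-1)^\<alpha> (x-1)^\<alpha>\<close> and the
  \<open>(-1)^(\<alpha>+2)\<close> coming from \<open>\<alpha>+2\<close> integrations by parts multiply to \<open>1\<close>.
\<close>

lemma boundary_form_derivative:
  assumes f: "f \<in> C_itv (2 * \<alpha> + 4)" and g: "g \<in> C_itv (2 * \<alpha> + 4)" and x: "-1 < x" "x \<le> 1"
  shows "(boundary_form \<alpha> \<beta> N f g has_real_derivative
      L_comb \<alpha> \<beta> N f x * g x * ((1 - x) ^ \<alpha> * (1 + x) powr \<beta>) - dirichlet \<alpha> \<beta> N f g x)
      (at x within {-1..1})"
proof -
  let ?w = "(1 - x) ^ \<alpha> * (1 + x) powr \<beta>"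
  let ?V = "\<lambda>k. D_itv k (lift \<alpha> g)"
  have "((\<lambda>x. \<Sum>k<\<alpha>+2. (-1) ^ k * ?V k x * flux \<alpha> \<beta> f (\<alpha> + 2 - 1 - k) x) has_real_derivative
      ?V 0 x * flux \<alpha> \<beta> f (\<alpha> + 2) x - (-1) ^ (\<alpha> + 2) * ?V (\<alpha> + 2) x * flux \<alpha> \<beta> f 0 x)
      (at x within {-1..1})"
    by (rule concomitant_derivative) (use lift_derivative[OF g] flux_derivative[OF f] x in auto)
  from DERIV_diff[OF DERIV_cmult[OF this, of "N * (-1) ^ \<alpha>"]
      DERIV_cmult[OF two_term_derivative[OF f g x, of \<beta>], of "C_const \<alpha> \<beta>"]]
  have D: "(boundary_form \<alpha> \<beta> N f g has_real_derivative
      N * (-1) ^ \<alpha> * (?V 0 x * flux \<alpha> \<beta> f (\<alpha> + 2) x - (-1) ^ (\<alpha> + 2) * ?V (\<alpha> + 2) x * flux \<alpha> \<beta> f 0 x)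
      - C_const \<alpha> \<beta> * ((1 - x) ^ (\<alpha> + 1) * (1 + x) powr (\<beta> + 1) * D_itv 1 f x * D_itv 1 g x
          - ?w * L_two \<alpha> \<beta> f x * g x)) (at x within {-1..1})"
    unfolding boundary_form_def by (simp only: mult.assoc)
  have "N * (-1) ^ \<alpha> * (?V 0 x * flux \<alpha> \<beta> f (\<alpha> + 2) x) = N * (?w * L_high \<alpha> \<beta> f x) * g x"
    unfolding weighted_L_high[OF f x] by (simp add: lift_def)
  moreover have "(-1) ^ \<alpha> * (-1) ^ (\<alpha> + 2) = (1::real)"
    by (simp flip: power_mult_distrib)
  then have "N * (-1) ^ \<alpha> * ((-1) ^ (\<alpha> + 2) * ?V (\<alpha> + 2) x * flux \<alpha> \<beta> f 0 x)
      = N * ?V (\<alpha> + 2) x * flux \<alpha> \<beta> f 0 x"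
    by (simp add: mult_ac)
  ultimately show ?thesis
    by (intro DERIV_cong[OF D], unfold right_diff_distrib)
       (simp only: L_comb_def dirichlet_def flux_0, simp add: algebra_simps)
qed

lemma continuous_on_boundary_form:
  assumes "\<beta> > -1" "f \<in> C_itv (2 * \<alpha> + 4)" "g \<in> C_itv (2 * \<alpha> + 4)"
  shows "continuous_on {-1..1} (boundary_form \<alpha> \<beta> N f g)"
proof -
  have "continuous_on {-1..1} g"
    using C_itv_continuous[OF assms(3), of 0] by simp
  then show ?thesis
    unfolding boundary_form_def
    by (intro continuous_intros continuous_on_one_plus_powr continuous_on_D_lift[OF assms(3)]
          continuous_on_flux[OF assms(1,2)] C_itv_continuous[OF assms(2)])
       (use assms(1) in auto)
qed

lemma boundary_form_at_minus_1: "boundary_form \<alpha> \<beta> N f g (-1) = 0"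
  by (simp add: boundary_form_def flux_at_minus_1)

text \<open>
  Only the last summand \<open>k = \<alpha>+1\<close> of the concomitant survives, since \<open>lift \<alpha> g\<close> has a zero of order
  \<open>\<alpha>+1\<close> at \<open>1\<close>. It pairs \<open>D^(\<alpha>+1) (lift \<alpha> g)\<close> with \<open>D^(\<alpha>+2) (lift \<alpha> f)\<close>, which leaves
  \<open>g 1\<close> and the first derivative of \<open>f\<close>.
\<close>

lemma boundary_form_at_1:
  assumes f: "f \<in> C_itv (2 * \<alpha> + 4)" and g: "g \<in> C_itv (2 * \<alpha> + 4)"
  shows "boundary_form \<alpha> \<beta> N f g 1 =
     - N * 2 powr (real \<alpha> + \<beta> + 2) * fact (\<alpha> + 1) * fact (\<alpha> + 2) * D_itv 1 f 1 * g 1"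
proof -
  have sign: "(-1) ^ \<alpha> * (-1) ^ (\<alpha> + 1) = (-1::real)"
    by (simp flip: power_mult_distrib)
  have "D_itv k (lift \<alpha> g) 1 = 0" if "k < \<alpha> + 1" for k
    using D_lift_at_1[OF g, of k \<alpha>] that by simp
  moreover have "{..<\<alpha>+2} = insert (\<alpha> + 1) {..<\<alpha>+1}" by auto
  ultimately have "(\<Sum>k<\<alpha>+2. (-1) ^ k * D_itv k (lift \<alpha> g) 1 * flux \<alpha> \<beta> f (\<alpha> + 2 - 1 - k) 1)
     = (-1) ^ (\<alpha> + 1) * D_itv (\<alpha> + 1) (lift \<alpha> g) 1 * flux \<alpha> \<beta> f 0 1"
    by simp
  then have "boundary_form \<alpha> \<beta> N f g 1
     = N * (-1) ^ \<alpha> * ((-1) ^ (\<alpha> + 1) * D_itv (\<alpha> + 1) (lift \<alpha> g) 1 * flux \<alpha> \<beta> f 0 1)"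
    by (simp add: boundary_form_def)
  also have "\<dots> = N * ((-1) ^ \<alpha> * (-1) ^ (\<alpha> + 1)) * D_itv (\<alpha> + 1) (lift \<alpha> g) 1 * flux \<alpha> \<beta> f 0 1"
    by (simp only: mult_ac)
  also have "D_itv (\<alpha> + 1) (lift \<alpha> g) 1 = fact (\<alpha> + 1) * g 1"
    using D_lift_at_1[OF g, of "\<alpha> + 1" \<alpha>] by simp
  also have "flux \<alpha> \<beta> f 0 1 = 2 powr (real \<alpha> + \<beta> + 2) * (fact (\<alpha> + 2) * D_itv 1 f 1)"
    using D_lift_at_1[OF f, of "\<alpha> + 2" \<alpha>] by (simp add: flux_0 algebra_simps)
  finally show ?thesis unfolding sign by (simp only: mult_ac mult_minus_left mult_minus_right mult_1)
qed

text \<open>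
  The \<open>dirichlet\<close> densities cancel by symmetry, so the difference of the two weighted products is the
  derivative of the antisymmetrised boundary form, and only its value at \<open>1\<close> contributes.
\<close>

lemma green_formula:
  assumes \<beta>: "\<beta> > -1" and f: "f \<in> C_itv (2 * \<alpha> + 4)" and g: "g \<in> C_itv (2 * \<alpha> + 4)"
  shows "((\<lambda>x. L_comb \<alpha> \<beta> N f x * g x * ((1 - x) ^ \<alpha> * (1 + x) powr \<beta>)
             - f x * L_comb \<alpha> \<beta> N g x * ((1 - x) ^ \<alpha> * (1 + x) powr \<beta>)) has_integral
      N * 2 powr (real \<alpha> + \<beta> + 2) * fact (\<alpha> + 1) * fact (\<alpha> + 2) *
        (f 1 * D_itv 1 g 1 - D_itv 1 f 1 * g 1)) {-1..1}"
proof -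
  let ?B = "\<lambda>x. boundary_form \<alpha> \<beta> N f g x - boundary_form \<alpha> \<beta> N g f x"
  have "((\<lambda>x. L_comb \<alpha> \<beta> N f x * g x * ((1 - x) ^ \<alpha> * (1 + x) powr \<beta>)
             - f x * L_comb \<alpha> \<beta> N g x * ((1 - x) ^ \<alpha> * (1 + x) powr \<beta>)) has_integral ?B 1 - ?B (-1)) {-1..1}"
  proof (rule fundamental_theorem_of_calculus_itv)
    show "continuous_on {-1..1} ?B"
      by (intro continuous_intros continuous_on_boundary_form assms)
    fix x :: real assume "x \<in> {-1<..<1}"
    then have x: "-1 < x" "x \<le> 1" by auto
    show "(?B has_real_derivative L_comb \<alpha> \<beta> N f x * g x * ((1 - x) ^ \<alpha> * (1 + x) powr \<beta>)
             - f x * L_comb \<alpha> \<beta> N g x * ((1 - x) ^ \<alpha> * (1 + x) powr \<beta>)) (at x within {-1..1})"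
      by (rule DERIV_cong[OF DERIV_diff[OF boundary_form_derivative[OF f g x]
              boundary_form_derivative[OF g f x]]])
         (simp add: dirichlet_commute[of \<alpha> \<beta> N g f])
  qed
  then show ?thesis
    by (rule has_integral_eq_rhs)
       (simp add: boundary_form_at_minus_1 boundary_form_at_1[OF f g] boundary_form_at_1[OF g f]
          right_diff_distrib mult_ac del: fact_Suc)
qed

section \<open>Symmetry\<close>

lemma L_comb_at_1: "L_comb \<alpha> \<beta> N f 1 = C_const \<alpha> \<beta> * (2 * real (\<alpha> + 1)) * D_itv 1 f 1"
  by (simp add: L_comb_def L_high_def L_two_def algebra_simps)

text \<open>
  This identity is what fixes the constant in front of \<open>L_two\<close>: it makes the boundary term of the
  high order part and the contribution of the point mass cancel.
\<close>

lemma jacobi_h_times_C_const: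
  assumes "\<beta> > -1"
  shows "jacobi_h \<alpha> \<beta> * (C_const \<alpha> \<beta> * (2 * real (\<alpha> + 1))) =
           2 powr (real \<alpha> + \<beta> + 2) * fact (\<alpha> + 1) * fact (\<alpha> + 2)"
proof -
  have "pochhammer (\<beta> + 1) (\<alpha> + 1) > 0" using assms by (intro pochhammer_pos) auto
  moreover have "2 powr (real \<alpha> + \<beta> + 2) = 2 powr (real \<alpha> + \<beta> + 1) * (2::real)"
    using powr_add[of 2 "real \<alpha> + \<beta> + 1" 1] by (simp add: add.assoc)
  moreover have "fact (\<alpha> + 1) = real (\<alpha> + 1) * fact \<alpha>" by simp
  moreover have "a * c / p * (m * p * (2 * k)) = a * 2 * (k * c) * m" if "p > 0" for a c p m k :: real
    using that by simp
  ultimately show ?thesis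
    unfolding jacobi_h_eq[OF assms] C_const_def by (simp only:)
qed

theorem theorem3p1:
  fixes \<alpha> :: nat and \<beta> N :: real and f g :: "real \<Rightarrow> real"
  assumes "\<beta> > -1" and "N > 0"
    and "f \<in> C_itv (2*\<alpha>+4)" and "g \<in> C_itv (2*\<alpha>+4)"
  shows "jacobi_sprod \<alpha> \<beta> N (L_comb \<alpha> \<beta> N f) g = jacobi_sprod \<alpha> \<beta> N f (L_comb \<alpha> \<beta> N g)"
proof -
  note \<beta> = assms(1) and f = assms(3) and g = assms(4)
  define h where "h = jacobi_h \<alpha> \<beta>"
  define w where "w x = (1 - x) ^ \<alpha> * (1 + x) powr \<beta>" for x :: real
  define Lf Lg where "Lf = L_comb \<alpha> \<beta> N f" and "Lg = L_comb \<alpha> \<beta> N g"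
  define c where "c = C_const \<alpha> \<beta> * (2 * real (\<alpha> + 1))"
  have "h > 0"
    using \<beta> pochhammer_pos[of "\<beta> + 1" "\<alpha> + 1"] unfolding h_def jacobi_h_eq[OF \<beta>] by simp
  have sprod: "jacobi_sprod \<alpha> \<beta> N p q = inverse h * integral {-1..1} (\<lambda>x. p x * q x * w x) + N * p 1 * q 1"
    for p q
  proof -
    have "(\<lambda>x. p x * q x * jacobi_weight \<alpha> \<beta> x) = (\<lambda>x. inverse h * (p x * q x * w x))"
      by (simp add: fun_eq_iff jacobi_weight_def h_def w_def)
    then show ?thesis by (simp add: jacobi_sprod_def)
  qed
  have cont: "continuous_on {-1..1} f" "continuous_on {-1..1} g"
    "continuous_on {-1..1} Lf" "continuous_on {-1..1} Lg"
    using C_itv_continuous[OF f, of 0] C_itv_continuous[OF g, of 0]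
      continuous_on_L_comb[OF f] continuous_on_L_comb[OF g] by (simp_all add: Lf_def Lg_def)
  have "integral {-1..1} (\<lambda>x. Lf x * g x * w x) - integral {-1..1} (\<lambda>x. f x * Lg x * w x)
      = integral {-1..1} (\<lambda>x. Lf x * g x * w x - f x * Lg x * w x)"
    unfolding w_def
    by (intro integral_diff[symmetric] integrable_continuous_mult_jacobi_weight \<beta> continuous_intros cont)
  also have "\<dots> = N * (h * c) * (f 1 * D_itv 1 g 1 - D_itv 1 f 1 * g 1)"
    unfolding w_def Lf_def Lg_def integral_unique[OF green_formula[OF \<beta> f g]]
    by (simp only: h_def c_def jacobi_h_times_C_const[OF \<beta>] mult.assoc)
  finally have "integral {-1..1} (\<lambda>x. Lf x * g x * w x) =
      integral {-1..1} (\<lambda>x. f x * Lg x * w x) + N * (h * c) * (f 1 * D_itv 1 g 1 - D_itv 1 f 1 * g 1)"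
    by simp
  moreover have "Lf 1 = c * D_itv 1 f 1" "Lg 1 = c * D_itv 1 g 1"
    by (simp_all add: Lf_def Lg_def c_def L_comb_at_1)
  ultimately have "jacobi_sprod \<alpha> \<beta> N Lf g = jacobi_sprod \<alpha> \<beta> N f Lg"
    unfolding sprod using \<open>h > 0\<close> by (simp add: field_simps)
  then show ?thesis by (simp only: Lf_def Lg_def)
qed

end
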